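(* Consider an MDP-JLS with ergodic unichain MDP $\mathcal{M}=(S,\hat{s},\Sigma,T)$ and mode matrices $A_s\in\mathbb{R}^{n\times n}$, $s\in S$. For each $s\in S$ let $0<\alpha_s<1$ and $\mu_s>1$ be constants, and assume there exists a Lyapunov function candidate $V=\{V_s : s\in S\}$, $V_s:\mathbb{R}^n\to\mathbb{R}$, such that for every pair $s,s'\in S$ and every $x\in\mathbb{R}^n$, $$V_s(A_sx)-V_s(x)\le-\alpha_s V_s(x),\qquad V_s(x)\le\mu_s V_{s'}(x).$$ Let $\pi$ be a policy whose induced DTMC, with transition matrix $P$, has a unique stationary distribution $p^\infty$, and let $\overrightarrow{p_s}=\sum_{s'\ne s}P(s',s)p^\infty_{s'}$. If $$\sum_{s\in S}\left(\overrightarrow{p_s}\ln\mu_s+p^\infty_s\ln(1-\alpha_s)\right)<0,$$ then the MJLS induced by $\pi$ is stable with probability one.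
   Context: An MDP is a tuple $\mathcal{M}=(S,\hat{s},\Sigma,T)$ with finite state set $S$, initial state $\hat s\in S$, finite action set $\Sigma$, and transition function $T(s,\sigma,s')=p(s'|s,\sigma)$. If $\sigma$ is available at $s$ then $T(s,\sigma,\cdot)$ is a probability distribution; otherwise $T(s,\sigma,\cdot)=0$ and policies do not select $\sigma$ at $s$. A policy $\pi:S\times\Sigma\to[0,1]$ gives the probability $\pi(s,\sigma)$ of taking action $\sigma$ at $s$. Under $\pi$ the MDP reduces to a discrete-time Markov chain (DTMC) $(S,\hat s,P)$ with $P(s,s')=\sum_{\sigma}T(s,\sigma,s')\pi(s,\sigma)$. A DTMC is an ergodic unichain if it has a single ergodic class (communicating class of recurrent aperiodic states) and possibly some transient states; an MDP is an ergodic unichain if every policy induces an ergodic unichain DTMC (so the stationary distribution exists and is unique). An MDP-JLS is the switched system $x(k+1)=A_{s_k}x(k)$, $x(k)\in\mathbb{R}^n$, where $s_k\in S$ is the mode at time $k$, with the mode process governed by $\mathcal{M}$. Given a policy it becomes a Markov jump linear system (MJLS): the modes follow the induced DTMC. An MJLS is stable with probability one if, for any initial condition $x_0$, $\lim_{k\to\infty}\|x(k)\|_\infty=0$ with probability one. Lyapunov function candidate: each $V_s$ is continuous, radially unbounded, $V_s(0)=0$ and $V_s(x)>0$ for $x\ne0$. *)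

theory Defs
  imports "HOL-Probability.Probability"
begin

definition dist_on :: "'b set \<Rightarrow> ('b \<Rightarrow> real) \<Rightarrow> bool" where
  "dist_on B p \<longleftrightarrow> (\<forall>b\<in>B. 0 \<le> p b) \<and> (\<Sum>b\<in>B. p b) = 1"


section \<open>Finite discrete-time Markov chains\<close>

text \<open>A transition matrix \<open>P\<close> is only meaningful on the carrier \<open>S\<close>, so all sums
  and quantifiers are restricted to \<open>S\<close>.\<close>

primrec nstep :: "'s set \<Rightarrow> ('s \<Rightarrow> 's \<Rightarrow> real) \<Rightarrow> nat \<Rightarrow> 's \<Rightarrow> 's \<Rightarrow> real" where
  "nstep S P 0 i j = of_bool (i = j)"
| "nstep S P (Suc n) i j = (\<Sum>k\<in>S. P i k * nstep S P n k j)"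

text \<open>\<open>first_passage S P n i j\<close> is the probability that the chain started in \<open>i\<close> visits \<open>j\<close>
  at time \<open>n + 1\<close> and at none of the times \<open>1, \<dots>, n\<close>.\<close>

primrec first_passage :: "'s set \<Rightarrow> ('s \<Rightarrow> 's \<Rightarrow> real) \<Rightarrow> nat \<Rightarrow> 's \<Rightarrow> 's \<Rightarrow> real" where
  "first_passage S P 0 i j = P i j"
| "first_passage S P (Suc n) i j = (\<Sum>k\<in>S - {j}. P i k * first_passage S P n k j)"

text \<open>Recurrence: the probability of ever returning to \<open>i\<close> is one.\<close>

definition recurrent :: "'s set \<Rightarrow> ('s \<Rightarrow> 's \<Rightarrow> real) \<Rightarrow> 's \<Rightarrow> bool" where
  "recurrent S P i \<longleftrightarrow> (\<lambda>n. first_passage S P n i i) sums 1"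

abbreviation transient :: "'s set \<Rightarrow> ('s \<Rightarrow> 's \<Rightarrow> real) \<Rightarrow> 's \<Rightarrow> bool" where
  "transient S P i \<equiv> \<not> recurrent S P i"

definition aperiodic :: "'s set \<Rightarrow> ('s \<Rightarrow> 's \<Rightarrow> real) \<Rightarrow> 's \<Rightarrow> bool" where
  "aperiodic S P i \<longleftrightarrow> Gcd {n. 0 < n \<and> 0 < nstep S P n i i} = 1"

definition accessible :: "'s set \<Rightarrow> ('s \<Rightarrow> 's \<Rightarrow> real) \<Rightarrow> 's \<Rightarrow> 's \<Rightarrow> bool" where
  "accessible S P i j \<longleftrightarrow> (\<exists>n. 0 < nstep S P n i j)"

definition communicating_class :: "'s set \<Rightarrow> ('s \<Rightarrow> 's \<Rightarrow> real) \<Rightarrow> 's set \<Rightarrow> bool" where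
  "communicating_class S P C \<longleftrightarrow>
     (\<exists>i\<in>S. C = {j\<in>S. accessible S P i j \<and> accessible S P j i})"

definition ergodic_class :: "'s set \<Rightarrow> ('s \<Rightarrow> 's \<Rightarrow> real) \<Rightarrow> 's set \<Rightarrow> bool" where
  "ergodic_class S P C \<longleftrightarrow>
     communicating_class S P C \<and> (\<forall>i\<in>C. recurrent S P i \<and> aperiodic S P i)"

text \<open>Requiring every state outside \<open>C\<close> to be transient makes \<open>C\<close> the only ergodic class.\<close>

definition ergodic_unichain :: "'s set \<Rightarrow> ('s \<Rightarrow> 's \<Rightarrow> real) \<Rightarrow> bool" where
  "ergodic_unichain S P \<longleftrightarrow>
     (\<exists>C. ergodic_class S P C \<and> (\<forall>i\<in>S - C. transient S P i))"

definition stationary :: "'s set \<Rightarrow> ('s \<Rightarrow> 's \<Rightarrow> real) \<Rightarrow> ('s \<Rightarrow> real) \<Rightarrow> bool" where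
  "stationary S P p \<longleftrightarrow> dist_on S p \<and> (\<forall>s\<in>S. (\<Sum>s'\<in>S. p s' * P s' s) = p s)"

definition unique_stationary :: "'s set \<Rightarrow> ('s \<Rightarrow> 's \<Rightarrow> real) \<Rightarrow> ('s \<Rightarrow> real) \<Rightarrow> bool" where
  "unique_stationary S P p \<longleftrightarrow>
     stationary S P p \<and> (\<forall>q. stationary S P q \<longrightarrow> (\<forall>s\<in>S. q s = p s))"

text \<open>The probability of entering \<open>s\<close> from a different state, in the stationary regime.\<close>

definition inflow :: "'s set \<Rightarrow> ('s \<Rightarrow> 's \<Rightarrow> real) \<Rightarrow> ('s \<Rightarrow> real) \<Rightarrow> 's \<Rightarrow> real" where
  "inflow S P p s = (\<Sum>s'\<in>S - {s}. P s' s * p s')"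

text \<open>\<open>X\<close> is a realisation, on the probability space \<open>\<Omega>\<close>, of the DTMC with states \<open>S\<close>,
  initial state \<open>s0\<close> and transition matrix \<open>P\<close>. The sequence \<open>h\<close> is a history of length \<open>k\<close>
  together with a successor state \<open>h (Suc k)\<close>.\<close>

definition dtmc_process ::
  "'s set \<Rightarrow> 's \<Rightarrow> ('s \<Rightarrow> 's \<Rightarrow> real) \<Rightarrow> 'w measure \<Rightarrow> (nat \<Rightarrow> 'w \<Rightarrow> 's) \<Rightarrow> bool" where
  "dtmc_process S s0 P \<Omega> X \<longleftrightarrow>
     prob_space \<Omega> \<and>
     (\<forall>k. X k \<in> measurable \<Omega> (count_space S)) \<and>
     (AE w in \<Omega>. X 0 w = s0) \<and>
     (\<forall>k h. (\<forall>i\<le>Suc k. h i \<in> S) \<longrightarrow>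
        0 < \<P>(w in \<Omega>. \<forall>i\<le>k. X i w = h i) \<longrightarrow>
        \<P>(w in \<Omega>. X (Suc k) w = h (Suc k) \<bar> \<forall>i\<le>k. X i w = h i) = P (h k) (h (Suc k)))"


section \<open>Markov decision processes\<close>

record ('s, 'a) mdp =
  states :: "'s set"
  initial :: 's
  actions :: "'a set"
  tprob :: "'s \<Rightarrow> 'a \<Rightarrow> 's \<Rightarrow> real"

text \<open>Availability is read off the transition function: it is a distribution at available
  actions and zero at all others.\<close>

definition available :: "('s, 'a) mdp \<Rightarrow> 's \<Rightarrow> 'a \<Rightarrow> bool" where
  "available M s \<sigma> \<longleftrightarrow> dist_on (states M) (tprob M s \<sigma>)"

definition is_mdp :: "('s, 'a) mdp \<Rightarrow> bool" where
  "is_mdp M \<longleftrightarrow>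
     finite (states M) \<and> initial M \<in> states M \<and> finite (actions M) \<and>
     (\<forall>s\<in>states M. \<forall>\<sigma>\<in>actions M.
        available M s \<sigma> \<or> (\<forall>s'\<in>states M. tprob M s \<sigma> s' = 0))"

definition is_policy :: "('s, 'a) mdp \<Rightarrow> ('s \<Rightarrow> 'a \<Rightarrow> real) \<Rightarrow> bool" where
  "is_policy M \<pi> \<longleftrightarrow>
     (\<forall>s\<in>states M. dist_on (actions M) (\<pi> s) \<and>
        (\<forall>\<sigma>\<in>actions M. \<not> available M s \<sigma> \<longrightarrow> \<pi> s \<sigma> = 0))"

definition induced :: "('s, 'a) mdp \<Rightarrow> ('s \<Rightarrow> 'a \<Rightarrow> real) \<Rightarrow> 's \<Rightarrow> 's \<Rightarrow> real" where
  "induced M \<pi> s s' = (\<Sum>\<sigma>\<in>actions M. tprob M s \<sigma> s' * \<pi> s \<sigma>)"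

definition ergodic_unichain_mdp :: "('s, 'a) mdp \<Rightarrow> bool" where
  "ergodic_unichain_mdp M \<longleftrightarrow>
     is_mdp M \<and> (\<forall>\<pi>. is_policy M \<pi> \<longrightarrow> ergodic_unichain (states M) (induced M \<pi>))"


section \<open>Markov jump linear systems\<close>

primrec jls :: "('s \<Rightarrow> real^'n^'n) \<Rightarrow> (nat \<Rightarrow> 's) \<Rightarrow> real^'n \<Rightarrow> nat \<Rightarrow> real^'n" where
  "jls A m x0 0 = x0"
| "jls A m x0 (Suc k) = A (m k) *v jls A m x0 k"

definition stable_with_probability_one ::
  "'w measure \<Rightarrow> (nat \<Rightarrow> 'w \<Rightarrow> 's) \<Rightarrow> ('s \<Rightarrow> real^'n^'n) \<Rightarrow> bool" where
  "stable_with_probability_one \<Omega> X A \<longleftrightarrow>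
     (\<forall>x0. AE w in \<Omega>. (\<lambda>k. infnorm (jls A (\<lambda>i. X i w) x0 k)) \<longlonglongrightarrow> 0)"

definition lyapunov_candidate :: "'s set \<Rightarrow> ('s \<Rightarrow> real^'n \<Rightarrow> real) \<Rightarrow> bool" where
  "lyapunov_candidate S V \<longleftrightarrow>
     (\<forall>s\<in>S. continuous_on UNIV (V s) \<and> filterlim (V s) at_top at_infinity \<and>
        V s 0 = 0 \<and> (\<forall>x. x \<noteq> 0 \<longrightarrow> 0 < V s x))"

end

theory Submission
  imports Defs
begin

text \<open>Along the mode sequence, \<open>V\<close> is bounded by the exponential of an additive functional with
  increments \<open>f i j = ln (1 - \<alpha> i) + [i \<noteq> j] ln (\<mu> j)\<close>, whose stationary mean is the negative sum in
  the hypothesis. Instead of invoking an ergodic theorem, uniqueness of the stationary distribution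
  yields \<open>g\<close> such that \<open>f i j + g j - g i\<close> has negative conditional mean in every state. For small
  \<open>\<theta> > 0\<close> the expectation of \<open>exp (\<theta> M)\<close>, \<open>M\<close> the sum of these modified increments, decays
  geometrically in time, so that \<open>exp (\<theta> M)\<close> is summable, hence tends to 0, almost surely.\<close>

section \<open>Averages of a finite Markov chain\<close>

text \<open>Bolzano-Weierstrass one coordinate at a time: each new state refines the subsequence
  found so far, and refining preserves the limits already obtained.\<close>

lemma finite_convergent_subseq:
  fixes q :: "nat \<Rightarrow> 's \<Rightarrow> real"
  assumes "finite S" and "\<And>n s. s \<in> S \<Longrightarrow> \<bar>q n s\<bar> \<le> B"
  shows "\<exists>l r. strict_mono (r :: nat \<Rightarrow> nat) \<and> (\<forall>s\<in>S. (\<lambda>n. q (r n) s) \<longlonglongrightarrow> l s)"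
  using assms
proof (induction S rule: finite_induct)
  case empty
  show ?case by (intro exI[of _ undefined] exI[of _ id]) (auto simp: strict_mono_def)
next
  case (insert t S)
  then obtain l r where r: "strict_mono (r :: nat \<Rightarrow> nat)"
    and l: "\<And>s. s \<in> S \<Longrightarrow> (\<lambda>n. q (r n) s) \<longlonglongrightarrow> l s"
    by (metis insertCI)
  have "bounded (range (\<lambda>n. q (r n) t))"
    using insert.prems by (auto simp: bounded_iff)
  then obtain c u where u: "strict_mono (u :: nat \<Rightarrow> nat)"
    and c: "((\<lambda>n. q (r n) t) \<circ> u) \<longlonglongrightarrow> c"
    using bounded_imp_convergent_subsequence by blast
  have "strict_mono (r \<circ> u)" using r u by (rule strict_mono_o)
  moreover have "(\<lambda>n. q ((r \<circ> u) n) s) \<longlonglongrightarrow> (l(t := c)) s" if "s \<in> insert t S" for s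
  proof (cases "s = t")
    case True
    then show ?thesis using c by (simp add: o_def)
  next
    case False
    then have "s \<in> S" using that by simp
    from LIMSEQ_subseq_LIMSEQ[OF l[OF this] u] show ?thesis
      using False by (simp add: o_def)
  qed
  ultimately show ?case by blast
qed

lemma dist_on_le_1:
  assumes "finite S" "dist_on S p" "s \<in> S"
  shows "p s \<le> 1"
  using assms member_le_sum[of s S p] by (auto simp: dist_on_def)

lemma dist_on_nstep:
  assumes "finite S" "\<And>i. i \<in> S \<Longrightarrow> dist_on S (P i)" "i \<in> S"
  shows "dist_on S (nstep S P n i)"
  using assms(3)
proof (induction n arbitrary: i)
  case 0
  then show ?case using assms(1) by (auto simp: dist_on_def of_bool_def)
next
  case (Suc n)
  have "(\<Sum>j\<in>S. nstep S P (Suc n) i j) = (\<Sum>k\<in>S. P i k * (\<Sum>j\<in>S. nstep S P n k j))"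
    by (simp add: sum_distrib_left) (rule sum.swap)
  also have "\<dots> = 1"
    using Suc assms(2) by (simp add: dist_on_def)
  finally show ?case
    using Suc assms(2) by (auto simp: dist_on_def intro!: sum_nonneg)
qed

text \<open>\<open>nstep\<close> peels off the first step; peeling off the last one instead lets
  \<open>P\<close> act from the right on occupation averages.\<close>

lemma nstep_Suc_right:
  assumes "finite S" "i \<in> S" "j \<in> S"
  shows "nstep S P (Suc n) i j = (\<Sum>k\<in>S. nstep S P n i k * P k j)"
  using assms(2)
proof (induction n arbitrary: i)
  case 0
  have "(\<Sum>k\<in>S. P i k * of_bool (k = j)) = P i j"
    using assms by (simp add: of_bool_def if_distrib cong: if_cong)
  moreover have "(\<Sum>k\<in>S. of_bool (i = k) * P k j) = P i j"
    using assms 0 by (simp add: of_bool_def if_distrib if_distribR cong: if_cong)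
  ultimately show ?case by simp
next
  case (Suc n)
  have "nstep S P (Suc (Suc n)) i j = (\<Sum>m\<in>S. P i m * nstep S P (Suc n) m j)" by simp
  also have "\<dots> = (\<Sum>m\<in>S. P i m * (\<Sum>k\<in>S. nstep S P n m k * P k j))"
    using Suc.IH by (intro sum.cong refl) simp
  also have "\<dots> = (\<Sum>k\<in>S. nstep S P (Suc n) i k * P k j)"
    by (simp add: sum_distrib_left sum_distrib_right mult.assoc) (rule sum.swap)
  finally show ?case .
qed

text \<open>The window is the times 1 to \<open>N\<close>, without time 0. This is what the
  telescoping in the Poisson equation leaves behind. For \<open>N = 0\<close> the value is
  0.\<close>

definition cesaro :: "'s set \<Rightarrow> ('s \<Rightarrow> 's \<Rightarrow> real) \<Rightarrow> nat \<Rightarrow> 's \<Rightarrow> 's \<Rightarrow> real" where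
  "cesaro S P N i j = (\<Sum>m<N. nstep S P (Suc m) i j) / real N"

lemma dist_on_cesaro:
  assumes "finite S" "\<And>i. i \<in> S \<Longrightarrow> dist_on S (P i)" "i \<in> S" "0 < N"
  shows "dist_on S (cesaro S P N i)"
proof -
  have D: "dist_on S (nstep S P n i)" for n
    using dist_on_nstep assms by metis
  have "(\<Sum>j\<in>S. cesaro S P N i j) = (\<Sum>m<N. \<Sum>j\<in>S. nstep S P (Suc m) i j) / real N"
    unfolding cesaro_def sum_divide_distrib[symmetric] by (subst sum.swap) simp
  also have "\<dots> = 1" using D assms(4) unfolding dist_on_def by (simp del: nstep.simps)
  finally show ?thesis
    using D unfolding dist_on_def cesaro_def by (auto intro!: divide_nonneg_nonneg sum_nonneg simp del: nstep.simps)
qed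

text \<open>One more step of the chain shifts the time window by one, so the difference telescopes
  to two boundary terms in [0, 1]. The bound is uniform in the starting state.\<close>

lemma cesaro_almost_invariant:
  assumes "finite S" "\<And>i. i \<in> S \<Longrightarrow> dist_on S (P i)" "i \<in> S" "s \<in> S"
  shows "\<bar>(\<Sum>k\<in>S. cesaro S P N i k * P k s) - cesaro S P N i s\<bar> \<le> 1 / real N"
proof -
  have "(\<Sum>k\<in>S. cesaro S P N i k * P k s)
      = (\<Sum>m<N. \<Sum>k\<in>S. nstep S P (Suc m) i k * P k s) / real N"
    unfolding cesaro_def times_divide_eq_left sum_distrib_right sum_divide_distrib[symmetric]
    by (subst sum.swap) simp
  also have "\<dots> = (\<Sum>m<N. nstep S P (Suc (Suc m)) i s) / real N"
    using nstep_Suc_right[OF assms(1,3,4), of P] by (simp del: nstep.simps)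
  finally have "(\<Sum>k\<in>S. cesaro S P N i k * P k s) - cesaro S P N i s
      = (\<Sum>m<N. nstep S P (Suc (Suc m)) i s - nstep S P (Suc m) i s) / real N"
    by (simp add: cesaro_def diff_divide_distrib sum_subtractf del: nstep.simps)
  also have "\<dots> = (nstep S P (Suc N) i s - nstep S P 1 i s) / real N"
    using sum_lessThan_telescope[of "\<lambda>m. nstep S P (Suc m) i s" N] by simp
  finally have eq: "(\<Sum>k\<in>S. cesaro S P N i k * P k s) - cesaro S P N i s
      = (nstep S P (Suc N) i s - nstep S P 1 i s) / real N" .
  have "0 \<le> nstep S P n i s \<and> nstep S P n i s \<le> 1" for n
    using dist_on_nstep[of S P i n] dist_on_le_1[of S "nstep S P n i" s] assms
    by (auto simp: dist_on_def)
  from this[of "Suc N"] this[of 1] have "\<bar>nstep S P (Suc N) i s - nstep S P 1 i s\<bar> \<le> 1"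
    by linarith
  then show ?thesis
    unfolding eq abs_divide by (simp add: divide_right_mono)
qed

text \<open>Any limit point of the occupation averages is stationary, whatever the starting states are;
  so uniqueness of the stationary distribution makes the averages converge uniformly.\<close>

lemma cesaro_mean_neg:
  assumes S: "finite S" and P: "\<And>i. i \<in> S \<Longrightarrow> dist_on S (P i)"
    and p: "unique_stationary S P p" and neg: "(\<Sum>s\<in>S. p s * f s) < 0"
  shows "\<exists>N>0. \<forall>i\<in>S. (\<Sum>j\<in>S. cesaro S P N i j * f j) < 0"
proof (rule ccontr)
  assume "\<not> ?thesis"
  then have "\<forall>N. \<exists>i\<in>S. 0 \<le> (\<Sum>j\<in>S. cesaro S P (Suc N) i j * f j)"
    by (metis not_le zero_less_Suc)
  then obtain i where i: "\<And>N. i N \<in> S"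
    and nonneg: "\<And>N. 0 \<le> (\<Sum>j\<in>S. cesaro S P (Suc N) (i N) j * f j)"
    by metis
  \<comment> \<open>The starting state \<open>i N\<close> may change with the length of the window;
    \<open>Suc N\<close> keeps that length positive, so that each \<open>q N\<close> is a
    distribution.\<close>
  define q where "q N = cesaro S P (Suc N) (i N)" for N
  have D: "dist_on S (q N)" for N
    unfolding q_def by (intro dist_on_cesaro S P i) simp_all
  have "\<bar>q N s\<bar> \<le> 1" if "s \<in> S" for N s
    using D[of N] dist_on_le_1[OF S D that] that by (auto simp: dist_on_def)
  from finite_convergent_subseq[OF S, of q, OF this]
  obtain l r where r: "strict_mono (r :: nat \<Rightarrow> nat)"
    and l: "\<And>s. s \<in> S \<Longrightarrow> (\<lambda>n. q (r n) s) \<longlonglongrightarrow> l s" by blast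
  have "dist_on S l"
    unfolding dist_on_def
  proof
    show "\<forall>s\<in>S. 0 \<le> l s"
      using LIMSEQ_le_const[OF l] D by (fastforce simp: dist_on_def)
    have "(\<lambda>n. \<Sum>s\<in>S. q (r n) s) \<longlonglongrightarrow> (\<Sum>s\<in>S. l s)"
      by (intro tendsto_sum l)
    then show "(\<Sum>s\<in>S. l s) = 1"
      using D by (simp add: dist_on_def LIMSEQ_const_iff)
  qed
  moreover have "(\<Sum>k\<in>S. l k * P k s) = l s" if s: "s \<in> S" for s
  proof -
    have "(\<lambda>n. (\<Sum>k\<in>S. q (r n) k * P k s) - q (r n) s) \<longlonglongrightarrow> (\<Sum>k\<in>S. l k * P k s) - l s"
      using s by (intro tendsto_intros l)
    \<comment> \<open>The defect of invariance is controlled by the window length alone, so varying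
      starting states do no harm.\<close>
    moreover have "(\<lambda>n. (\<Sum>k\<in>S. q (r n) k * P k s) - q (r n) s) \<longlonglongrightarrow> 0"
    proof (rule Lim_null_comparison)
      show "\<forall>\<^sub>F n in sequentially.
          norm ((\<Sum>k\<in>S. q (r n) k * P k s) - q (r n) s) \<le> 1 / real (Suc (r n))"
        unfolding q_def real_norm_def
        by (intro always_eventually allI cesaro_almost_invariant S P i s)
      show "(\<lambda>n. 1 / real (Suc (r n))) \<longlonglongrightarrow> 0"
        using LIMSEQ_subseq_LIMSEQ[OF LIMSEQ_inverse_real_of_nat r]
        by (simp add: o_def inverse_eq_divide)
    qed
    ultimately show ?thesis using LIMSEQ_unique by force
  qed
  ultimately have "stationary S P l" by (auto simp: stationary_def)
  \<comment> \<open>Uniqueness identifies the limit point with \<open>p\<close>. The limit of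
    nonnegative averages of \<open>f\<close> would then be the negative stationary mean.\<close>
  then have "\<And>s. s \<in> S \<Longrightarrow> l s = p s" using p by (auto simp: unique_stationary_def)
  moreover have "(\<lambda>n. \<Sum>s\<in>S. q (r n) s * f s) \<longlonglongrightarrow> (\<Sum>s\<in>S. l s * f s)"
    by (intro tendsto_intros l)
  then have "0 \<le> (\<Sum>s\<in>S. l s * f s)"
    using nonneg by (intro LIMSEQ_le_const) (auto simp: q_def)
  ultimately show False using neg by simp
qed

text \<open>With \<open>a m i\<close> the mean of \<open>f\<close> after \<open>m\<close> steps from \<open>i\<close>, the function
  \<open>g = (1/N) \<Sum>m<N. \<Sum>n\<le>m. a n\<close> solves the Poisson equation up to the Cesaro average of \<open>f\<close>.\<close>

lemma negative_drift:
  assumes S: "finite S" and P: "\<And>i. i \<in> S \<Longrightarrow> dist_on S (P i)"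
    and p: "unique_stationary S P p" and neg: "(\<Sum>s\<in>S. p s * f s) < 0"
  shows "\<exists>g. \<forall>i\<in>S. f i + (\<Sum>j\<in>S. P i j * g j) - g i < 0"
proof -
  obtain N where N: "0 < N" and ces: "\<And>i. i \<in> S \<Longrightarrow> (\<Sum>j\<in>S. cesaro S P N i j * f j) < 0"
    using cesaro_mean_neg[OF S P p neg] by blast
  define a where "a n i = (\<Sum>j\<in>S. nstep S P n i j * f j)" for n i
  have a0: "a 0 i = f i" if "i \<in> S" for i
    using that S by (simp add: a_def of_bool_def if_distrib if_distribR cong: if_cong)
  have aS: "a (Suc n) i = (\<Sum>k\<in>S. P i k * a n k)" for n i
    unfolding a_def nstep.simps sum_distrib_left sum_distrib_right mult.assoc by (rule sum.swap)
  define g where "g i = (\<Sum>m<N. \<Sum>n\<le>m. a n i) / real N" for i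
  have "f i + (\<Sum>j\<in>S. P i j * g j) - g i = (\<Sum>j\<in>S. cesaro S P N i j * f j)" if i: "i \<in> S" for i
  proof -
    have "(\<Sum>j\<in>S. P i j * g j) = (\<Sum>m<N. \<Sum>n\<le>m. \<Sum>j\<in>S. P i j * a n j) / real N"
      unfolding g_def times_divide_eq_right sum_divide_distrib[symmetric] sum_distrib_left
      by (subst sum.swap, subst (2) sum.swap) simp
    also have "\<dots> - g i = (\<Sum>m<N. \<Sum>n\<le>m. a (Suc n) i - a n i) / real N"
      by (simp add: g_def aS diff_divide_distrib sum_subtractf)
    \<comment> \<open>The inner sum over \<open>n\<close> telescopes, and its lower end
      \<open>a 0 i\<close> is \<open>f i\<close>.\<close>
    also have "\<dots> = (\<Sum>m<N. a (Suc m) i - f i) / real N"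
      using sum_Suc_diff[of 0 _ "\<lambda>n. a n i"] a0[OF i] by (simp only: atMost_atLeast0)
    also have "\<dots> = (\<Sum>m<N. a (Suc m) i) / real N - f i"
      using N by (simp add: sum_subtractf diff_divide_distrib)
    also have "(\<Sum>m<N. a (Suc m) i) / real N = (\<Sum>j\<in>S. cesaro S P N i j * f j)"
      unfolding a_def cesaro_def times_divide_eq_left sum_distrib_right sum_divide_distrib[symmetric]
      by (subst sum.swap) simp
    finally show ?thesis by simp
  qed
  then show ?thesis using ces by (intro exI[of _ g]) simp
qed

section \<open>Exponential tilting\<close>

text \<open>As a function of \<theta>, each exponential moment equals 1 at 0 and has there the mean
  of \<open>d i\<close> as derivative, which is negative. It is thus below 1 just to the right of 0,
  and finitely many states admit a common \<theta> and a common \<rho>.\<close>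

lemma exponential_tilt:
  assumes S: "finite S" "S \<noteq> {}" and P: "\<And>i. i \<in> S \<Longrightarrow> dist_on S (P i)"
    and d: "\<And>i. i \<in> S \<Longrightarrow> (\<Sum>j\<in>S. P i j * d i j) < 0"
  shows "\<exists>\<theta>>0. \<exists>\<rho>. 0 \<le> \<rho> \<and> \<rho> < 1 \<and> (\<forall>i\<in>S. (\<Sum>j\<in>S. P i j * exp (\<theta> * d i j)) \<le> \<rho>)"
proof -
  define \<phi> where "\<phi> i \<theta> = (\<Sum>j\<in>S. P i j * exp (\<theta> * d i j))" for i and \<theta> :: real
  have "\<forall>\<^sub>F \<theta> in at_right 0. \<phi> i \<theta> < 1" if i: "i \<in> S" for i
  proof -
    have "(\<phi> i has_real_derivative (\<Sum>j\<in>S. P i j * d i j)) (at 0)"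
      unfolding \<phi>_def by (auto intro!: derivative_eq_intros sum.cong simp: mult_ac)
    from DERIV_neg_dec_right[OF this d[OF i]]
    obtain e where "0 < e" "\<And>h. 0 < h \<Longrightarrow> h < e \<Longrightarrow> \<phi> i h < \<phi> i 0" by auto
    moreover have "\<phi> i 0 = 1" using P[OF i] by (simp add: \<phi>_def dist_on_def)
    ultimately show ?thesis unfolding eventually_at_right_field by (intro exI[of _ e]) simp
  qed
  then have "\<forall>\<^sub>F \<theta> in at_right 0. \<forall>i\<in>S. \<phi> i \<theta> < 1"
    using S(1) by (simp add: eventually_ball_finite)
  then obtain b where "0 < b" "\<And>\<theta>. 0 < \<theta> \<Longrightarrow> \<theta> < b \<Longrightarrow> \<forall>i\<in>S. \<phi> i \<theta> < 1"
    unfolding eventually_at_right_field by auto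
  \<comment> \<open>Any point strictly between 0 and \<open>b\<close> would serve; the midpoint is
    taken.\<close>
  then have \<theta>: "0 < b / 2" "\<forall>i\<in>S. \<phi> i (b / 2) < 1" by auto
  define \<rho> where "\<rho> = Max ((\<lambda>i. \<phi> i (b / 2)) ` S)"
  have "\<rho> < 1" using S \<theta> by (simp add: \<rho>_def)
  moreover have le: "\<phi> i (b / 2) \<le> \<rho>" if "i \<in> S" for i using S that by (simp add: \<rho>_def)
  moreover have "0 \<le> \<rho>"
  proof -
    obtain i where i: "i \<in> S" using S by blast
    have "0 \<le> \<phi> i (b / 2)" using P[OF i] by (auto simp: \<phi>_def dist_on_def intro!: sum_nonneg)
    then show ?thesis using le[OF i] by simp
  qed
  ultimately show ?thesis using \<theta>(1) unfolding \<phi>_def by blast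
qed

section \<open>Law of finite paths and exponential moments of additive functionals\<close>

definition path_sum :: "('s \<Rightarrow> 's \<Rightarrow> real) \<Rightarrow> (nat \<Rightarrow> 's) \<Rightarrow> nat \<Rightarrow> real" where
  "path_sum d h k = (\<Sum>i<k. d (h i) (h (Suc i)))"

lemma path_sum_cong:
  "(\<And>i. i \<le> k \<Longrightarrow> h i = h' i) \<Longrightarrow> path_sum d h k = path_sum d h' k"
  by (simp add: path_sum_def)

definition path_event :: "'w measure \<Rightarrow> (nat \<Rightarrow> 'w \<Rightarrow> 's) \<Rightarrow> nat \<Rightarrow> (nat \<Rightarrow> 's) \<Rightarrow> 'w set" where
  "path_event \<Omega> X k h = {w \<in> space \<Omega>. \<forall>i\<le>k. X i w = h i}"

lemma path_event_sets:
  assumes "dtmc_process S s0 P \<Omega> X" "finite S" "\<And>i. i \<le> k \<Longrightarrow> h i \<in> S"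
  shows "path_event \<Omega> X k h \<in> sets \<Omega>"
proof -
  have "X i \<in> measurable \<Omega> (count_space S)" for i
    using assms(1) by (simp add: dtmc_process_def)
  then have "{w \<in> space \<Omega>. X i w = h i} \<in> sets \<Omega>" if "i \<le> k" for i
    using measurable_sets[of "X i" \<Omega> "count_space S" "{h i}"] assms(3)[OF that]
    by (simp add: vimage_def Int_def conj_commute)
  then have "(\<Inter>i\<in>{..k}. {w \<in> space \<Omega>. X i w = h i}) \<in> sets \<Omega>"
    by (intro sets.finite_INT) auto
  also have "(\<Inter>i\<in>{..k}. {w \<in> space \<Omega>. X i w = h i}) = path_event \<Omega> X k h"
    by (auto simp: path_event_def)
  finally show ?thesis .
qed

text \<open>This is the Markov property for cylinder events. The process prescribes conditional
  probabilities only after histories of positive probability; after a null history both sides vanish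
  by monotonicity.\<close>

lemma prob_path_event_Suc:
  assumes X: "dtmc_process S s0 P \<Omega> X" and S: "finite S"
    and h: "\<And>i. i \<le> k \<Longrightarrow> h i \<in> S" and j: "j \<in> S"
  shows "measure \<Omega> (path_event \<Omega> X (Suc k) (h(Suc k := j)))
    = measure \<Omega> (path_event \<Omega> X k h) * P (h k) j"
proof -
  interpret prob_space \<Omega> using X by (simp add: dtmc_process_def)
  let ?h = "h(Suc k := j)"
  have h': "\<forall>i\<le>Suc k. ?h i \<in> S" using h j by (auto simp: le_Suc_eq)
  have ev: "path_event \<Omega> X k ?h = path_event \<Omega> X k h"
    by (auto simp: path_event_def)
  have ev': "path_event \<Omega> X (Suc k) ?h
      = {w \<in> space \<Omega>. X (Suc k) w = ?h (Suc k) \<and> (\<forall>i\<le>k. X i w = ?h i)}"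
    by (auto simp: path_event_def le_Suc_eq)
  show ?thesis
  proof (cases "prob (path_event \<Omega> X k h) = 0")
    case True
    have "prob (path_event \<Omega> X (Suc k) ?h) \<le> prob (path_event \<Omega> X k h)"
    proof (rule finite_measure_mono)
      show "path_event \<Omega> X (Suc k) ?h \<subseteq> path_event \<Omega> X k h"
        by (auto simp: path_event_def)
      show "path_event \<Omega> X k h \<in> sets \<Omega>"
        using h by (rule path_event_sets[OF X S])
    qed
    then show ?thesis using True by (simp add: measure_le_0_iff)
  next
    case False
    then have pos: "0 < prob (path_event \<Omega> X k ?h)"
      unfolding ev by (simp add: zero_less_measure_iff)
    have "\<P>(w in \<Omega>. X (Suc k) w = ?h (Suc k) \<bar> \<forall>i\<le>k. X i w = ?h i) = P (?h k) (?h (Suc k))"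
      using X h' pos unfolding dtmc_process_def path_event_def by blast
    then have "prob (path_event \<Omega> X (Suc k) ?h) / prob (path_event \<Omega> X k ?h) = P (h k) j"
      unfolding cond_prob_def ev' unfolding path_event_def by simp
    then show ?thesis using pos unfolding ev by (simp add: field_simps)
  qed
qed

text \<open>Up to time \<open>k\<close> the path takes finitely many values, and their cylinders
  partition the space, so the expectation is a finite sum. Extensional functions on
  \<open>{..k}\<close> index every path exactly once.\<close>

lemma nn_integral_exp_path_sum:
  assumes X: "dtmc_process S s0 P \<Omega> X" and S: "finite S"
  shows "(\<integral>\<^sup>+ w. ennreal (exp (path_sum d (\<lambda>i. X i w) k)) \<partial>\<Omega>)
    = ennreal (\<Sum>h\<in>{..k} \<rightarrow>\<^sub>E S. exp (path_sum d h k) * measure \<Omega> (path_event \<Omega> X k h))"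
proof -
  interpret prob_space \<Omega> using X by (simp add: dtmc_process_def)
  let ?H = "{..k} \<rightarrow>\<^sub>E S"
  have H: "finite ?H" using S by (simp add: finite_PiE)
  have meas: "path_event \<Omega> X k h \<in> sets \<Omega>" if "h \<in> ?H" for h
    using that by (intro path_event_sets[OF X S]) auto
  have split: "ennreal (exp (path_sum d (\<lambda>i. X i w) k))
      = (\<Sum>h\<in>?H. ennreal (exp (path_sum d h k)) * indicator (path_event \<Omega> X k h) w)"
    if w: "w \<in> space \<Omega>" for w
  proof -
    have XS: "X i w \<in> S" for i
      using X w by (auto simp: dtmc_process_def dest!: spec[of _ i] measurable_space)
    \<comment> \<open>The only index whose cylinder contains \<open>w\<close>: the path of
      \<open>w\<close> itself, cut off after time \<open>k\<close>.\<close>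
    define h0 where "h0 = restrict (\<lambda>i. X i w) {..k}"
    have h0: "h0 \<in> ?H" using XS by (auto simp: h0_def)
    have ind: "indicator (path_event \<Omega> X k h) w = (if h = h0 then 1 else 0 :: ennreal)"
      if "h \<in> ?H" for h
    proof -
      have "(\<forall>i\<le>k. X i w = h i) \<longleftrightarrow> h = h0"
        using that h0 PiE_ext[of h "{..k}" "\<lambda>_. S" h0] by (auto simp: h0_def)
      then show ?thesis using w by (auto simp: path_event_def indicator_def)
    qed
    have "(\<Sum>h\<in>?H. ennreal (exp (path_sum d h k)) * indicator (path_event \<Omega> X k h) w)
        = (\<Sum>h\<in>?H. if h = h0 then ennreal (exp (path_sum d h0 k)) else 0)"
      by (intro sum.cong refl) (simp add: ind)
    also have "\<dots> = ennreal (exp (path_sum d h0 k))" using H h0 by simp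
    also have "path_sum d h0 k = path_sum d (\<lambda>i. X i w) k"
      by (rule path_sum_cong) (simp add: h0_def)
    finally show ?thesis by simp
  qed
  have "(\<integral>\<^sup>+ w. ennreal (exp (path_sum d (\<lambda>i. X i w) k)) \<partial>\<Omega>)
      = (\<integral>\<^sup>+ w. (\<Sum>h\<in>?H. ennreal (exp (path_sum d h k)) * indicator (path_event \<Omega> X k h) w) \<partial>\<Omega>)"
    by (rule nn_integral_cong) (rule split)
  also have "\<dots> = (\<Sum>h\<in>?H. ennreal (exp (path_sum d h k)) * emeasure \<Omega> (path_event \<Omega> X k h))"
    using meas by (simp add: nn_integral_sum nn_integral_cmult_indicator)
  also have "\<dots> = ennreal (\<Sum>h\<in>?H. exp (path_sum d h k) * prob (path_event \<Omega> X k h))"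
    by (subst sum_ennreal[symmetric]) (auto simp: emeasure_eq_measure ennreal_mult)
  finally show ?thesis .
qed

text \<open>A path up to time \<open>Suc k\<close> is a path up to time \<open>k\<close> together
  with a last state; this drives the induction on time.\<close>

lemma sum_PiE_atMost_Suc:
  "(\<Sum>h\<in>{..Suc k} \<rightarrow>\<^sub>E S. F h) = (\<Sum>h\<in>{..k} \<rightarrow>\<^sub>E S. \<Sum>j\<in>S. F (h(Suc k := j)))"
proof -
  have inj: "inj_on (\<lambda>(y, g). g(Suc k := y)) (S \<times> ({..k} \<rightarrow>\<^sub>E S))"
    by (rule inj_combinator) simp
  have "(\<Sum>h\<in>{..Suc k} \<rightarrow>\<^sub>E S. F h) = (\<Sum>(y, g)\<in>S \<times> ({..k} \<rightarrow>\<^sub>E S). F (g(Suc k := y)))"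
    unfolding atMost_Suc PiE_insert_eq
    by (subst sum.reindex[OF inj]) (simp add: o_def case_prod_unfold)
  also have "\<dots> = (\<Sum>y\<in>S. \<Sum>g\<in>{..k} \<rightarrow>\<^sub>E S. F (g(Suc k := y)))"
    by (simp add: sum.cartesian_product)
  finally show ?thesis by (simp add: sum.swap[of _ S])
qed

text \<open>Given the path up to time \<open>k\<close>, the factor of the next transition has mean
  at most \<rho>, so every step multiplies the expectation by at most \<rho>. The parameter \<theta>
  of the tilting is absorbed into \<open>d\<close>.\<close>

lemma exp_path_sum_decay:
  assumes X: "dtmc_process S s0 P \<Omega> X" and S: "finite S" and \<rho>: "0 \<le> \<rho>"
    and tilt: "\<And>i. i \<in> S \<Longrightarrow> (\<Sum>j\<in>S. P i j * exp (d i j)) \<le> \<rho>"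
  shows "(\<integral>\<^sup>+ w. ennreal (exp (path_sum d (\<lambda>i. X i w) k)) \<partial>\<Omega>) \<le> ennreal (\<rho> ^ k)"
proof -
  interpret prob_space \<Omega> using X by (simp add: dtmc_process_def)
  define E where
    "E k = (\<Sum>h\<in>{..k} \<rightarrow>\<^sub>E S. exp (path_sum d h k) * prob (path_event \<Omega> X k h))" for k
  have step: "E (Suc k) \<le> \<rho> * E k" for k
  proof -
    have "E (Suc k) = (\<Sum>h\<in>{..k} \<rightarrow>\<^sub>E S. \<Sum>j\<in>S. exp (path_sum d (h(Suc k := j)) (Suc k))
        * prob (path_event \<Omega> X (Suc k) (h(Suc k := j))))"
      unfolding E_def by (rule sum_PiE_atMost_Suc)
    also have "\<dots> = (\<Sum>h\<in>{..k} \<rightarrow>\<^sub>E S. exp (path_sum d h k) * prob (path_event \<Omega> X k h)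
        * (\<Sum>j\<in>S. P (h k) j * exp (d (h k) j)))"
    proof (rule sum.cong[OF refl])
      fix h assume h: "h \<in> {..k} \<rightarrow>\<^sub>E S"
      have "exp (path_sum d (h(Suc k := j)) (Suc k)) = exp (path_sum d h k) * exp (d (h k) j)" for j
        by (simp add: path_sum_def exp_add)
      moreover have "prob (path_event \<Omega> X (Suc k) (h(Suc k := j)))
          = prob (path_event \<Omega> X k h) * P (h k) j" if "j \<in> S" for j
        using h that by (intro prob_path_event_Suc[OF X S]) auto
      ultimately show "(\<Sum>j\<in>S. exp (path_sum d (h(Suc k := j)) (Suc k))
            * prob (path_event \<Omega> X (Suc k) (h(Suc k := j))))
          = exp (path_sum d h k) * prob (path_event \<Omega> X k h)
            * (\<Sum>j\<in>S. P (h k) j * exp (d (h k) j))"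
        by (simp add: sum_distrib_left mult_ac)
    qed
    also have "\<dots> \<le> (\<Sum>h\<in>{..k} \<rightarrow>\<^sub>E S. exp (path_sum d h k) * prob (path_event \<Omega> X k h) * \<rho>)"
      by (intro sum_mono mult_left_mono tilt) auto
    also have "\<dots> = \<rho> * E k" by (simp add: E_def sum_distrib_left mult_ac)
    finally show ?thesis .
  qed
  \<comment> \<open>At time 0 the path sum is empty, so the integral formula read backwards gives
    the total mass 1.\<close>
  have "ennreal (E 0) = (\<integral>\<^sup>+ w. ennreal (exp (path_sum d (\<lambda>i. X i w) 0)) \<partial>\<Omega>)"
    unfolding E_def by (rule nn_integral_exp_path_sum[OF X S, symmetric])
  also have "\<dots> = 1" by (simp add: path_sum_def emeasure_space_1)
  finally have "E 0 = 1" by simp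
  then have "E k \<le> \<rho> ^ k"
  proof (induction k)
    case (Suc k)
    have "\<rho> * E k \<le> \<rho> * \<rho> ^ k" using Suc \<rho> by (intro mult_left_mono) auto
    with step[of k] show ?case by simp
  qed simp
  then show ?thesis
    unfolding nn_integral_exp_path_sum[OF X S] E_def by (rule ennreal_leI)
qed

text \<open>The expectations are dominated by a geometric series. By monotone convergence the random
  series has finite expectation, so it converges almost surely and its terms vanish.\<close>

lemma AE_exp_path_sum_tendsto_0:
  assumes X: "dtmc_process S s0 P \<Omega> X" and S: "finite S" and \<rho>: "0 \<le> \<rho>" "\<rho> < 1"
    and tilt: "\<And>i. i \<in> S \<Longrightarrow> (\<Sum>j\<in>S. P i j * exp (d i j)) \<le> \<rho>"
  shows "AE w in \<Omega>. (\<lambda>k. exp (path_sum d (\<lambda>i. X i w) k)) \<longlonglongrightarrow> 0"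
proof -
  have Xm: "X i \<in> measurable \<Omega> (count_space S)" for i
    using X by (simp add: dtmc_process_def)
  have pair: "(\<lambda>w. d (X i w) (X j w)) \<in> borel_measurable \<Omega>" for i j
  proof -
    have "(\<lambda>w. (\<lambda>x. d x (X j w)) (X i w)) \<in> borel_measurable \<Omega>"
    proof (rule measurable_compose_countable'[where g = "X i" and I = S])
      show "X i \<in> measurable \<Omega> (count_space S)" by (rule Xm)
      show "countable S" using S by (rule countable_finite)
      show "(\<lambda>w. d s (X j w)) \<in> borel_measurable \<Omega>" for s
        by (rule measurable_compose[OF Xm]) simp
    qed
    then show ?thesis .
  qed
  have meas: "(\<lambda>w. ennreal (exp (path_sum d (\<lambda>i. X i w) k))) \<in> borel_measurable \<Omega>" for k
    unfolding path_sum_def using pair by measurable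
  have "(\<integral>\<^sup>+ w. (\<Sum>k. ennreal (exp (path_sum d (\<lambda>i. X i w) k))) \<partial>\<Omega>)
      = (\<Sum>k. \<integral>\<^sup>+ w. ennreal (exp (path_sum d (\<lambda>i. X i w) k)) \<partial>\<Omega>)"
    by (rule nn_integral_suminf) (rule meas)
  also have "\<dots> \<le> (\<Sum>k. ennreal (\<rho> ^ k))"
    by (intro suminf_le exp_path_sum_decay[OF X S \<rho>(1) tilt]) auto
  also have "\<dots> < \<infinity>"
    using \<rho> by (subst suminf_ennreal2) auto
  finally have "AE w in \<Omega>. (\<Sum>k. ennreal (exp (path_sum d (\<lambda>i. X i w) k))) \<noteq> \<infinity>"
    using meas by (intro nn_integral_PInf_AE borel_measurable_suminf) auto
  then show ?thesis
  proof (rule AE_mp, intro AE_I2 impI)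
    fix w assume "(\<Sum>k. ennreal (exp (path_sum d (\<lambda>i. X i w) k))) \<noteq> \<infinity>"
    then have "summable (\<lambda>k. exp (path_sum d (\<lambda>i. X i w) k))"
      by (intro summable_suminf_not_top) auto
    then show "(\<lambda>k. exp (path_sum d (\<lambda>i. X i w) k)) \<longlonglongrightarrow> 0"
      by (rule summable_LIMSEQ_zero)
  qed
qed

text \<open>The coboundary of the drift function \<open>g\<close> changes path sums only by a bounded amount.\<close>

lemma AE_exp_path_sum_tendsto_0_stationary:
  assumes X: "dtmc_process S s0 P \<Omega> X" and S: "finite S" "S \<noteq> {}"
    and P: "\<And>i. i \<in> S \<Longrightarrow> dist_on S (P i)"
    and p: "unique_stationary S P p"
    and neg: "(\<Sum>i\<in>S. p i * (\<Sum>j\<in>S. P i j * f i j)) < 0"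
  shows "AE w in \<Omega>. (\<lambda>k. exp (path_sum f (\<lambda>i. X i w) k)) \<longlonglongrightarrow> 0"
proof -
  obtain g where g: "\<And>i. i \<in> S \<Longrightarrow> (\<Sum>j\<in>S. P i j * f i j) + (\<Sum>j\<in>S. P i j * g j) - g i < 0"
    using negative_drift[OF S(1) P p neg] by blast
  define d where "d i j = f i j + g j - g i" for i j
  have "(\<Sum>j\<in>S. P i j * d i j) < 0" if i: "i \<in> S" for i
  proof -
    have "(\<Sum>j\<in>S. P i j * d i j)
        = (\<Sum>j\<in>S. P i j * f i j) + (\<Sum>j\<in>S. P i j * g j) - (\<Sum>j\<in>S. P i j) * g i"
      by (simp add: d_def algebra_simps sum.distrib sum_subtractf sum_distrib_left)
    then show ?thesis using g[OF i] P[OF i] by (simp add: dist_on_def)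
  qed
  from exponential_tilt[where P = P, OF S P this] obtain \<theta> \<rho> where \<theta>: "0 < \<theta>" and \<rho>: "0 \<le> \<rho>" "\<rho> < 1"
    and tilt: "\<And>i. i \<in> S \<Longrightarrow> (\<Sum>j\<in>S. P i j * exp (\<theta> * d i j)) \<le> \<rho>"
    by blast
  define B where "B = Max ((\<lambda>s. \<bar>g s\<bar>) ` S)"
  have B: "\<bar>g s\<bar> \<le> B" if "s \<in> S" for s using S that by (simp add: B_def)
  have "AE w in \<Omega>. (\<lambda>k. exp (path_sum (\<lambda>i j. \<theta> * d i j) (\<lambda>i. X i w) k)) \<longlonglongrightarrow> 0"
    using tilt by (rule AE_exp_path_sum_tendsto_0[OF X S(1) \<rho>])
  then show ?thesis
  proof (rule AE_mp, intro AE_I2 impI)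
    fix w assume w: "w \<in> space \<Omega>"
      and lim: "(\<lambda>k. exp (path_sum (\<lambda>i j. \<theta> * d i j) (\<lambda>i. X i w) k)) \<longlonglongrightarrow> 0"
    have XS: "X i w \<in> S" for i
      using X w by (auto simp: dtmc_process_def dest!: spec[of _ i] measurable_space)
    have scale: "path_sum (\<lambda>i j. \<theta> * d i j) (\<lambda>i. X i w) k
        = \<theta> * (path_sum f (\<lambda>i. X i w) k + g (X k w) - g (X 0 w))" for k
      by (induction k) (simp_all add: path_sum_def d_def algebra_simps)
    \<comment> \<open>The exponentials tend to 0 through positive values, so taking logarithms sends
      the scaled path sums to minus infinity.\<close>
    have "filterlim (\<lambda>k. exp (path_sum (\<lambda>i j. \<theta> * d i j) (\<lambda>i. X i w) k)) (at_right 0) sequentially"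
      using lim by (simp add: filterlim_at)
    from filterlim_compose[OF ln_at_0 this]
    have bot: "filterlim (\<lambda>k. \<theta> * (path_sum f (\<lambda>i. X i w) k + g (X k w) - g (X 0 w)))
        at_bot sequentially"
      by (simp add: scale)
    have "filterlim (\<lambda>k. path_sum f (\<lambda>i. X i w) k) at_bot sequentially"
      unfolding filterlim_at_bot
    proof
      \<comment> \<open>The margin \<open>2 * B\<close> absorbs the boundary terms
        \<open>g (X k w)\<close> and \<open>g (X 0 w)\<close>, each at most \<open>B\<close> in
        absolute value.\<close>
      fix Z
      have "\<forall>\<^sub>F k in sequentially.
          \<theta> * (path_sum f (\<lambda>i. X i w) k + g (X k w) - g (X 0 w)) \<le> \<theta> * (Z - 2 * B)"
        using bot by (simp add: filterlim_at_bot)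
      then show "\<forall>\<^sub>F k in sequentially. path_sum f (\<lambda>i. X i w) k \<le> Z"
      proof eventually_elim
        case (elim k)
        then have "path_sum f (\<lambda>i. X i w) k + g (X k w) - g (X 0 w) \<le> Z - 2 * B"
          using \<theta> by simp
        then show ?case using B[OF XS[of k]] B[OF XS[of 0]] by linarith
      qed
    qed
    then show "(\<lambda>k. exp (path_sum f (\<lambda>i. X i w) k)) \<longlonglongrightarrow> 0"
      by (rule filterlim_compose[OF exp_at_bot])
  qed
qed

section \<open>Lyapunov functions\<close>

text \<open>Radial unboundedness gives \<open>F x \<ge> 1\<close> outside a ball of radius
  \<open>R\<close>; the shell that remains is compact, so \<open>F\<close> attains a positive
  minimum there unless the shell is empty.\<close>

lemma lyapunov_bounded_below:
  fixes F :: "real^'n \<Rightarrow> real"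
  assumes cont: "continuous_on UNIV F" and top: "filterlim F at_top at_infinity"
    and pos: "\<And>x. x \<noteq> 0 \<Longrightarrow> 0 < F x" and \<delta>: "0 < \<delta>"
  shows "\<exists>m>0. \<forall>x. \<delta> \<le> norm x \<longrightarrow> m \<le> F x"
proof -
  from top have "\<forall>\<^sub>F x in at_infinity. 1 \<le> F x" by (simp add: filterlim_at_top)
  then obtain R where R: "\<And>x. R \<le> norm x \<Longrightarrow> 1 \<le> F x"
    by (auto simp: eventually_at_infinity)
  let ?K = "{x :: real^'n. \<delta> \<le> norm x} \<inter> cball 0 R"
  have "closed {x :: real^'n. \<delta> \<le> norm x}"
    by (intro closed_Collect_le continuous_intros)
  then have K: "compact ?K" by (intro closed_Int_compact) auto
  show ?thesis
  proof (cases "?K = {}")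
    case True
    have "1 \<le> F x" if "\<delta> \<le> norm x" for x
      using True that R[of x] by (cases "norm x \<le> R") auto
    then show ?thesis by (intro exI[of _ 1]) auto
  next
    case False
    then obtain z where z: "z \<in> ?K" "\<And>x. x \<in> ?K \<Longrightarrow> F z \<le> F x"
      using continuous_attains_inf[OF K False continuous_on_subset[OF cont]] by blast
    have "0 < F z" using z(1) \<delta> by (intro pos) auto
    moreover have "min 1 (F z) \<le> F x" if "\<delta> \<le> norm x" for x
      using z(2)[of x] R[of x] that by (cases "norm x \<le> R") auto
    ultimately show ?thesis by (intro exI[of _ "min 1 (F z)"]) auto
  qed
qed

text \<open>The mode may change at every time, so the values are compared with the smallest of the
  finitely many lower bounds \<open>b s\<close>, which is still positive.\<close>

lemma lyapunov_tendsto_0: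
  fixes x :: "nat \<Rightarrow> real^'n"
  assumes S: "finite S" and V: "lyapunov_candidate S V" and m: "\<And>k. m k \<in> S"
    and lim: "(\<lambda>k. V (m k) (x k)) \<longlonglongrightarrow> 0"
  shows "x \<longlonglongrightarrow> 0"
proof (rule tendstoI)
  fix \<delta> :: real assume \<delta>: "0 < \<delta>"
  have "\<exists>b>0. \<forall>y. \<delta> \<le> norm y \<longrightarrow> b \<le> V s y" if "s \<in> S" for s
    using V that by (intro lyapunov_bounded_below \<delta>) (auto simp: lyapunov_candidate_def)
  then obtain b where b: "\<And>s. s \<in> S \<Longrightarrow> 0 < b s"
    "\<And>s y. s \<in> S \<Longrightarrow> \<delta> \<le> norm y \<Longrightarrow> b s \<le> V s y" by metis
  have ne: "S \<noteq> {}" using m by blast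
  have "0 < Min (b ` S)" using b S ne by simp
  with lim have "\<forall>\<^sub>F k in sequentially. V (m k) (x k) < Min (b ` S)"
    by (rule order_tendstoD)
  then show "\<forall>\<^sub>F k in sequentially. dist (x k) 0 < \<delta>"
  proof eventually_elim
    case (elim k)
    then have "V (m k) (x k) < b (m k)" using S m Min_le[of "b ` S" "b (m k)"] by fastforce
    then show ?case using b(2)[OF m[of k], of "x k"] by (auto simp: not_le[symmetric])
  qed
qed

section \<open>Growth of the Lyapunov function along a mode sequence\<close>

text \<open>The logarithm of the factor bounding the growth of \<open>V\<close> while mode
  \<open>i\<close> acts and mode \<open>j\<close> follows. Staying in a mode changes no Lyapunov
  function and costs no \<mu>.\<close>

definition log_gain :: "('s \<Rightarrow> real) \<Rightarrow> ('s \<Rightarrow> real) \<Rightarrow> 's \<Rightarrow> 's \<Rightarrow> real" where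
  "log_gain \<alpha> \<mu> i j = ln (1 - \<alpha> i) + (if i = j then 0 else ln (\<mu> j))"

lemma lyapunov_le_path_sum:
  fixes A :: "'s \<Rightarrow> real^'n^'n"
  assumes \<alpha>: "\<And>s. s \<in> S \<Longrightarrow> \<alpha> s < 1" and \<mu>: "\<And>s. s \<in> S \<Longrightarrow> 0 < \<mu> s"
    and dec: "\<And>s x. s \<in> S \<Longrightarrow> V s (A s *v x) - V s x \<le> - \<alpha> s * V s x"
    and jump: "\<And>s s' x. s \<in> S \<Longrightarrow> s' \<in> S \<Longrightarrow> V s x \<le> \<mu> s * V s' x"
    and m: "\<And>k. m k \<in> S"
  shows "V (m k) (jls A m x0 k) \<le> exp (path_sum (log_gain \<alpha> \<mu>) m k) * V (m 0) x0"
proof (induction k)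
  case 0
  show ?case by (simp add: path_sum_def)
next
  case (Suc k)
  let ?x = "jls A m x0" and ?c = "if m k = m (Suc k) then 1 else \<mu> (m (Suc k))"
  have c: "0 < ?c" using \<mu>[OF m] by simp
  have a: "0 < 1 - \<alpha> (m k)" using \<alpha>[OF m] by simp
  have gain: "exp (log_gain \<alpha> \<mu> (m k) (m (Suc k))) = ?c * (1 - \<alpha> (m k))"
    using a \<mu>[OF m] by (simp add: log_gain_def exp_add)
  \<comment> \<open>The switch is undone first, at the new point \<open>?x (Suc k)\<close>. Then
    both points are measured by the function of mode \<open>m k\<close>, whose matrix was applied,
    and its decrease condition fits.\<close>
  have "V (m (Suc k)) (?x (Suc k)) \<le> ?c * V (m k) (?x (Suc k))"
    using jump[OF m m] by simp
  also have "\<dots> \<le> ?c * ((1 - \<alpha> (m k)) * V (m k) (?x k))"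
    using dec[OF m, of k "?x k"] c by (intro mult_left_mono) (auto simp: algebra_simps)
  also have "\<dots> = exp (log_gain \<alpha> \<mu> (m k) (m (Suc k))) * V (m k) (?x k)"
    unfolding gain by (simp only: mult.assoc)
  also have "\<dots> \<le> exp (log_gain \<alpha> \<mu> (m k) (m (Suc k)))
      * (exp (path_sum (log_gain \<alpha> \<mu>) m k) * V (m 0) x0)"
    by (intro mult_left_mono Suc.IH) simp
  also have "\<dots> = exp (path_sum (log_gain \<alpha> \<mu>) m (Suc k)) * V (m 0) x0"
    by (simp add: path_sum_def exp_add)
  finally show ?case .
qed

text \<open>Exchanging the two sums groups the switches by the state they enter, and the stationary
  weight of those into \<open>j\<close> is the inflow of \<open>j\<close>. The rows of
  \<open>P\<close> sum to 1, which isolates the contraction term.\<close>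

lemma log_gain_mean:
  assumes S: "finite S" and P: "\<And>i. i \<in> S \<Longrightarrow> dist_on S (P i)"
  shows "(\<Sum>i\<in>S. p i * (\<Sum>j\<in>S. P i j * log_gain \<alpha> \<mu> i j))
    = (\<Sum>s\<in>S. inflow S P p s * ln (\<mu> s) + p s * ln (1 - \<alpha> s))"
proof -
  have "(\<Sum>j\<in>S. P i j * log_gain \<alpha> \<mu> i j)
      = ln (1 - \<alpha> i) + (\<Sum>j\<in>S. if i = j then 0 else P i j * ln (\<mu> j))" if "i \<in> S" for i
  proof -
    have "(\<Sum>j\<in>S. P i j * log_gain \<alpha> \<mu> i j)
        = (\<Sum>j\<in>S. P i j) * ln (1 - \<alpha> i) + (\<Sum>j\<in>S. if i = j then 0 else P i j * ln (\<mu> j))"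
      unfolding sum_distrib_right sum.distrib[symmetric]
      by (intro sum.cong) (auto simp: log_gain_def algebra_simps)
    then show ?thesis using P[OF that] by (simp add: dist_on_def)
  qed
  then have "(\<Sum>i\<in>S. p i * (\<Sum>j\<in>S. P i j * log_gain \<alpha> \<mu> i j))
      = (\<Sum>i\<in>S. p i * ln (1 - \<alpha> i))
        + (\<Sum>i\<in>S. \<Sum>j\<in>S. p i * (if i = j then 0 else P i j * ln (\<mu> j)))"
    by (simp add: distrib_left sum.distrib sum_distrib_left)
  also have "(\<Sum>i\<in>S. \<Sum>j\<in>S. p i * (if i = j then 0 else P i j * ln (\<mu> j)))
      = (\<Sum>j\<in>S. \<Sum>i\<in>S. p i * (if i = j then 0 else P i j * ln (\<mu> j)))"
    by (rule sum.swap)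
  also have "\<dots> = (\<Sum>j\<in>S. inflow S P p j * ln (\<mu> j))"
  proof (rule sum.cong[OF refl])
    fix j assume "j \<in> S"
    then have "(\<Sum>i\<in>S. p i * (if i = j then 0 else P i j * ln (\<mu> j)))
        = (\<Sum>i\<in>S - {j}. p i * (if i = j then 0 else P i j * ln (\<mu> j)))"
      using S by (simp add: sum.remove[of S j])
    also have "\<dots> = inflow S P p j * ln (\<mu> j)"
      unfolding inflow_def sum_distrib_right by (intro sum.cong) auto
    finally show "(\<Sum>i\<in>S. p i * (if i = j then 0 else P i j * ln (\<mu> j))) = inflow S P p j * ln (\<mu> j)" .
  qed
  finally show ?thesis by (simp add: sum.distrib)
qed

section \<open>The induced chain and almost sure stability\<close>

lemma dist_on_induced:
  assumes M: "is_mdp M" and \<pi>: "is_policy M \<pi>" and s: "s \<in> states M"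
  shows "dist_on (states M) (induced M \<pi> s)"
proof -
  have pi: "dist_on (actions M) (\<pi> s)" and un: "\<And>a. a \<in> actions M \<Longrightarrow> \<not> available M s a \<Longrightarrow> \<pi> s a = 0"
    using \<pi> s by (auto simp: is_policy_def)
  have nn: "0 \<le> tprob M s a s' * \<pi> s a" if "a \<in> actions M" "s' \<in> states M" for a s'
    using that un[OF that(1)] pi by (cases "available M s a") (auto simp: available_def dist_on_def)
  have "(\<Sum>s'\<in>states M. induced M \<pi> s s') = (\<Sum>a\<in>actions M. (\<Sum>s'\<in>states M. tprob M s a s') * \<pi> s a)"
    unfolding induced_def sum_distrib_right by (rule sum.swap)
  also have "\<dots> = (\<Sum>a\<in>actions M. \<pi> s a)"
  proof (rule sum.cong[OF refl])
    fix a assume "a \<in> actions M"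
    then show "(\<Sum>s'\<in>states M. tprob M s a s') * \<pi> s a = \<pi> s a"
      using un by (cases "available M s a") (auto simp: available_def dist_on_def)
  qed
  finally show ?thesis
    using pi nn by (auto simp: dist_on_def induced_def intro!: sum_nonneg)
qed

theorem theorem5:
  fixes M :: "('s, 'a) mdp"
    and A :: "'s \<Rightarrow> real^'n^'n"
    and \<alpha> \<mu> :: "'s \<Rightarrow> real"
    and V :: "'s \<Rightarrow> real^'n \<Rightarrow> real"
    and \<pi> :: "'s \<Rightarrow> 'a \<Rightarrow> real"
    and p :: "'s \<Rightarrow> real"
    and \<Omega> :: "'w measure"
    and X :: "nat \<Rightarrow> 'w \<Rightarrow> 's"
  defines "S \<equiv> states M"
    and "P \<equiv> induced M \<pi>"
  assumes "ergodic_unichain_mdp M"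
    and "\<And>s. s \<in> S \<Longrightarrow> 0 < \<alpha> s \<and> \<alpha> s < 1"
    and "\<And>s. s \<in> S \<Longrightarrow> 1 < \<mu> s"
    and "lyapunov_candidate S V"
    and "\<And>s x. s \<in> S \<Longrightarrow> V s (A s *v x) - V s x \<le> - \<alpha> s * V s x"
    and "\<And>s s' x. s \<in> S \<Longrightarrow> s' \<in> S \<Longrightarrow> V s x \<le> \<mu> s * V s' x"
    and "is_policy M \<pi>"
    and "unique_stationary S P p"
    and "(\<Sum>s\<in>S. inflow S P p s * ln (\<mu> s) + p s * ln (1 - \<alpha> s)) < 0"
    and "dtmc_process S (initial M) P \<Omega> X"
  shows "stable_with_probability_one \<Omega> X A"
proof -
  have M: "is_mdp M" using assms(3) by (simp add: ergodic_unichain_mdp_def)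
  then have S: "finite S" "S \<noteq> {}" by (auto simp: is_mdp_def S_def)
  have P: "dist_on S (P i)" if "i \<in> S" for i
    using dist_on_induced[OF M assms(9)] that by (simp add: S_def P_def)
  have neg: "(\<Sum>i\<in>S. p i * (\<Sum>j\<in>S. P i j * log_gain \<alpha> \<mu> i j)) < 0"
    using assms(11) by (subst log_gain_mean[OF S(1) P])
  \<comment> \<open>The exceptional null set is fixed before \<open>x0\<close>, so a single one
    serves all initial conditions.\<close>
  have AE: "AE w in \<Omega>. (\<lambda>k. exp (path_sum (log_gain \<alpha> \<mu>) (\<lambda>i. X i w) k)) \<longlonglongrightarrow> 0"
    by (rule AE_exp_path_sum_tendsto_0_stationary[OF assms(12) S P assms(10) neg])
  show ?thesis
    unfolding stable_with_probability_one_def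
  proof
    fix x0 :: "real^'n"
    from AE show "AE w in \<Omega>. (\<lambda>k. infnorm (jls A (\<lambda>i. X i w) x0 k)) \<longlonglongrightarrow> 0"
    proof (rule AE_mp, intro AE_I2 impI)
      fix w assume w: "w \<in> space \<Omega>"
        and lim: "(\<lambda>k. exp (path_sum (log_gain \<alpha> \<mu>) (\<lambda>i. X i w) k)) \<longlonglongrightarrow> 0"
      let ?x = "jls A (\<lambda>i. X i w) x0"
      have XS: "X i w \<in> S" for i
        using assms(12) w by (auto simp: dtmc_process_def dest!: spec[of _ i] measurable_space)
      \<comment> \<open>The upper bound is the vanishing exponential times
        \<open>V (X 0 w) x0\<close>, which depends on \<open>w\<close> but not on
        \<open>k\<close>.\<close>
      have "(\<lambda>k. V (X k w) (?x k)) \<longlonglongrightarrow> 0"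
      proof (rule tendsto_sandwich[OF _ _ tendsto_const])
        show "\<forall>\<^sub>F k in sequentially. 0 \<le> V (X k w) (?x k)"
          using assms(6) XS by (intro always_eventually allI)
            (metis lyapunov_candidate_def less_eq_real_def)
        have "V (X k w) (?x k)
            \<le> exp (path_sum (log_gain \<alpha> \<mu>) (\<lambda>i. X i w) k) * V (X 0 w) x0" for k
          using assms(4,5,7,8) XS
          by (intro lyapunov_le_path_sum[where m = "\<lambda>i. X i w" and S = S]) force+
        then show "\<forall>\<^sub>F k in sequentially. V (X k w) (?x k)
            \<le> exp (path_sum (log_gain \<alpha> \<mu>) (\<lambda>i. X i w) k) * V (X 0 w) x0"
          by (intro always_eventually allI)
        show "(\<lambda>k. exp (path_sum (log_gain \<alpha> \<mu>) (\<lambda>i. X i w) k) * V (X 0 w) x0) \<longlonglongrightarrow> 0"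
          using tendsto_mult_right[OF lim, of "V (X 0 w) x0"] by simp
      qed
      then have "?x \<longlonglongrightarrow> 0"
        by (rule lyapunov_tendsto_0[OF S(1) assms(6) XS])
      then show "(\<lambda>k. infnorm (?x k)) \<longlonglongrightarrow> 0"
        using tendsto_infnorm[of ?x 0] by (simp add: infnorm_0)
    qed
  qed
qed

end
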